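(* Let $N,L\ge 1$ be integers, let $\mathbf{a}_1,\dots,\mathbf{a}_L\in\mathbb{C}^N$ and let $b_1,\dots,b_L\in\mathbb{R}$ be not all zero. For $\ell=1,\dots,L$ put $$\mathbf{A}_\ell=\frac{b_\ell\sum_{i=1}^L b_i\mathbf{a}_i\mathbf{a}_i^{\mathrm H}}{\sqrt{L}\sum_{j=1}^L b_j^2}-\frac{\mathbf{a}_\ell\mathbf{a}_\ell^{\mathrm H}}{\sqrt{L}},$$ and define the beampattern similarity metric $f_{\mathrm{beam}}(\mathbf{x})=\frac1L\sum_{\ell=1}^L|\mathbf{x}^{\mathrm H}\mathbf{A}_\ell\mathbf{x}|^2$ for $\mathbf{x}\in\mathbb{C}^N$. Then for every $\mathbf{x}\in\mathbb{C}^N$ and every $\varphi\in\mathbb{R}$, $$f_{\mathrm{beam}}(e^{\mathrm{j}\varphi}\mathbf{x})=f_{\mathrm{beam}}(\mathbf{x}).$$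
   Context: $(\cdot)^{\mathrm H}$ is the conjugate transpose and $\mathrm{j}$ is the imaginary unit. The vector $\mathbf{a}_\ell$ is the array steering vector at the $\ell$-th angle and $b_\ell$ is the desired beampattern at that angle; $\mathbf{x}$ is the transmit signal in one time slot. *)

theory Defs
  imports "HOL-Analysis.Analysis"
begin

definition outer_prod :: "complex ^ 'n \<Rightarrow> complex ^ 'n \<Rightarrow> complex ^ 'n ^ 'n" where
  "outer_prod u v = (\<chi> i j. u $ i * cnj (v $ j))"  (* u v^H *)

definition quad_form :: "complex ^ 'n ^ 'n \<Rightarrow> complex ^ 'n \<Rightarrow> complex" where
  "quad_form A x = (\<Sum>i\<in>UNIV. cnj (x $ i) * (A *v x) $ i)"  (* x^H A x *)

(* The families a (steering vectors) and b (desired beampattern) are relevant only at indices 1..L. *)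
definition beam_mat ::
  "nat \<Rightarrow> (nat \<Rightarrow> complex ^ 'n) \<Rightarrow> (nat \<Rightarrow> real) \<Rightarrow> nat \<Rightarrow> complex ^ 'n ^ 'n" where
  "beam_mat L a b l =
     (b l *\<^sub>R (\<Sum>i=1..L. b i *\<^sub>R outer_prod (a i) (a i))) /\<^sub>R (sqrt (real L) * (\<Sum>j=1..L. (b j)\<^sup>2))
     - outer_prod (a l) (a l) /\<^sub>R sqrt (real L)"

definition f_beam ::
  "nat \<Rightarrow> (nat \<Rightarrow> complex ^ 'n) \<Rightarrow> (nat \<Rightarrow> real) \<Rightarrow> complex ^ 'n \<Rightarrow> real" where
  "f_beam L a b x = 1 / real L * (\<Sum>l=1..L. (cmod (quad_form (beam_mat L a b l) x))\<^sup>2)"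

end

theory Submission
  imports Defs
begin

text \<open>Each summand of \<open>f_beam\<close> sees x only through a form x^H A x, which is
  conjugate-linear in its left and linear in its right argument. Scaling x by c thus multiplies the
  form by |c|^2, which is 1 for a phase.\<close>

lemma quad_form_vector_smult:
  "quad_form A (c *s x) = (complex_of_real (cmod c))\<^sup>2 * quad_form A x"
proof -
  \<comment> \<open>\<open>c\<close> leaves \<open>A *v x\<close> by linearity, \<open>cnj c\<close>
    comes from the conjugated entry; their product is |c|^2.\<close>
  have "quad_form A (c *s x) = (\<Sum>i\<in>UNIV. (c * cnj c) * (cnj (x $ i) * (A *v x) $ i))"
    by (simp add: quad_form_def vector_scalar_commute mult_ac)
  then show ?thesis
    by (simp add: quad_form_def sum_distrib_left complex_norm_square [symmetric])
qed

theorem mainTheorem1: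
  fixes L :: nat
    and a :: "nat \<Rightarrow> complex ^ 'n"
    and b :: "nat \<Rightarrow> real"
    and x :: "complex ^ 'n"
    and \<phi> :: real
  assumes "L \<ge> 1"
    and "\<exists>l\<in>{1..L}. b l \<noteq> 0"
  shows "f_beam L a b (exp (\<i> * complex_of_real \<phi>) *s x) = f_beam L a b x"
  \<comment> \<open>The factor has modulus 1 since \<phi> is real.\<close>
  by (simp add: f_beam_def quad_form_vector_smult)

end
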